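(* $$\limsup_{n\to\infty}\ \gamma_{D_\infty}(n,n)^{1/n}=3+2\sqrt{2}.$$
   Context: The infinite dihedral group is $D_\infty=\mathbb{Z}\rtimes\{\pm1\}$, with underlying set $\mathbb{Z}\times\{\pm1\}$ and product $(a_1,b_1)(a_2,b_2)=(a_1+b_1a_2,\,b_1b_2)$. For a subset $S$ of a group, $S^n=\{s_1\cdots s_n : s_1,\dots,s_n\in S\}$, and $\gamma_{D_\infty}(k,n)=\max\{|S^n| : S\subset D_\infty,\ |S|=k\}$. *)

theory Defs
  imports "HOL-Algebra.Group" "HOL-Analysis.Extended_Real_Limits"
begin

definition infinite_dihedral_group :: "(int \<times> int) monoid" where
  "infinite_dihedral_group =
     \<lparr> carrier = UNIV \<times> {1, -1},
       monoid.mult = (\<lambda>(a1, b1) (a2, b2). (a1 + b1 * a2, b1 * b2)),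
       one = (0, 1) \<rparr>"

lemma infinite_dihedral_group_is_group: "group infinite_dihedral_group"
proof (rule groupI)
  fix x assume "x \<in> carrier infinite_dihedral_group"
  then obtain a b where x: "x = (a, b)" and b: "b = 1 \<or> b = -1"
    by (auto simp: infinite_dihedral_group_def)
  show "\<exists>y\<in>carrier infinite_dihedral_group.
      y \<otimes>\<^bsub>infinite_dihedral_group\<^esub> x = \<one>\<^bsub>infinite_dihedral_group\<^esub>"
    by (rule bexI[of _ "(- b * a, b)"]) (use b in \<open>auto simp: x infinite_dihedral_group_def\<close>)
qed (auto simp: infinite_dihedral_group_def algebra_simps)

definition set_power :: "('a, 'b) monoid_scheme \<Rightarrow> 'a set \<Rightarrow> nat \<Rightarrow> 'a set" where
  "set_power G S n = {foldr (\<otimes>\<^bsub>G\<^esub>) xs \<one>\<^bsub>G\<^esub> | xs. set xs \<subseteq> S \<and> length xs = n}"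

lemma set_power_eq_image:
  "set_power G S n = (\<lambda>xs. foldr (\<otimes>\<^bsub>G\<^esub>) xs \<one>\<^bsub>G\<^esub>) ` {xs. set xs \<subseteq> S \<and> length xs = n}"
  by (auto simp: set_power_def)

lemma finite_set_power: "finite S \<Longrightarrow> finite (set_power G S n)"
  by (simp add: set_power_eq_image finite_lists_length_eq)

lemma card_set_power_le: "finite S \<Longrightarrow> card (set_power G S n) \<le> card S ^ n"
  unfolding set_power_eq_image card_lists_length_eq[symmetric]
  by (rule card_image_le) (rule finite_lists_length_eq)

text \<open>
  The maximum ranges over infinitely many sets \<open>S\<close>, but over only finitely many values,
  since \<^term>\<open>card (set_power G S n) \<le> k ^ n\<close>.  The condition \<^term>\<open>finite S\<close> matters only
  for \<^term>\<open>k = (0::nat)\<close>, because \<^const>\<open>card\<close> sends infinite sets to 0.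
\<close>

definition product_growth :: "('a, 'b) monoid_scheme \<Rightarrow> nat \<Rightarrow> nat \<Rightarrow> nat" where
  "product_growth G k n =
     Max {card (set_power G S n) | S. S \<subseteq> carrier G \<and> finite S \<and> card S = k}"

lemma finite_product_growth_values:
  "finite {card (set_power G S n) | S. S \<subseteq> carrier G \<and> finite S \<and> card S = k}"
  by (rule finite_subset[of _ "{..k ^ n}"]) (auto intro: card_set_power_le)

lemma infinite_dihedral_group_infinite: "infinite (carrier infinite_dihedral_group)"
  by (auto simp: infinite_dihedral_group_def finite_cartesian_product_iff)

lemma product_growth_values_nonempty:
  "{card (set_power infinite_dihedral_group S n) | S.
      S \<subseteq> carrier infinite_dihedral_group \<and> finite S \<and> card S = k} \<noteq> {}"
proof -
  obtain S where "finite S" "card S = k" "S \<subseteq> carrier infinite_dihedral_group"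
    using infinite_arbitrarily_large[OF infinite_dihedral_group_infinite, of k] by blast
  then show ?thesis by blast
qed

end

theory Submission
  imports Defs "HOL-Analysis.Convex"
begin

text \<open>
  A word of length \<open>n\<close> over a set \<open>S\<close> has the value \<open>(\<Sum>s\<in>S. v s * fst s, \<plusminus>1)\<close>, where \<open>v s\<close> counts
  the occurrences of \<open>s\<close> with the sign of the prefix before them.  The integer vector \<open>v\<close> has
  \<open>l1\<close>-norm at most \<open>n\<close>, and its coefficient sum over the reflections determines the second
  component.  Hence \<open>|S^n|\<close> is at most the number of lattice points of the \<open>l1\<close>-ball of radius
  \<open>n\<close> in dimension \<open>|S|\<close>, a Delannoy number.  Conversely, if \<open>S\<close> consists of the identity, one
  reflection and \<open>m = n - 2\<close> translations by powers of a large base, then all lattice points of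
  the \<open>l1\<close>-ball of radius \<open>m\<close> in dimension \<open>m\<close> yield different elements of \<open>S^n\<close>.  The central
  Delannoy numbers lie between \<open>(3 + 2 * sqrt 2)^n / (n + 1)\<close> and \<open>(3 + 2 * sqrt 2)^n\<close>.
\<close>

section \<open>Delannoy numbers and the growth of the central ones\<close>

text \<open>Summand \<open>k\<close> counts the points of the l1-ball with exactly \<open>k\<close>
  nonzero coordinates: \<open>d choose k\<close> supports, \<open>2 ^ k\<close> sign patterns and
  \<open>r choose k\<close> tuples of \<open>k\<close> positive integers with sum at most
  \<open>r\<close>.\<close>

definition delannoy :: "nat \<Rightarrow> nat \<Rightarrow> nat" where
  "delannoy d r = (\<Sum>k\<le>d. (d choose k) * (r choose k) * 2 ^ k)"

lemma delannoy_0_left [simp]: "delannoy 0 r = 1"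
  by (simp add: delannoy_def)

lemma delannoy_0_right [simp]: "delannoy d 0 = 1"
proof -
  have "delannoy d 0 = (\<Sum>k\<le>d. if k = 0 then 1 else 0)"
    unfolding delannoy_def by (intro sum.cong) auto
  then show ?thesis by simp
qed

lemma delannoy_extend:
  assumes "d \<le> m"
  shows "delannoy d r = (\<Sum>k\<le>m. (d choose k) * (r choose k) * 2 ^ k)"
  unfolding delannoy_def using assms by (intro sum.mono_neutral_left) (auto simp: not_le)

text \<open>Pascal's rule in the first argument gives \<open>split\<close>. Pascal's rule in the
  second turns the sum for \<open>Suc r\<close> into \<open>2 * delannoy d r + ?T\<close>, and
  \<open>split\<close> at \<open>r\<close> eliminates \<open>?T\<close>.\<close>

lemma delannoy_Suc_Suc:
  "delannoy (Suc d) (Suc r) = delannoy d (Suc r) + delannoy (Suc d) r + delannoy d r"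
proof -
  let ?T = "\<Sum>k\<le>d. (d choose k) * (r choose Suc k) * 2 ^ Suc k"
  have split: "delannoy (Suc d) s = delannoy d s
      + (\<Sum>k\<le>d. (d choose k) * (s choose Suc k) * 2 ^ Suc k)" for s
  proof -
    have "delannoy (Suc d) s
        = 1 + (\<Sum>k\<le>d. (Suc d choose Suc k) * (s choose Suc k) * 2 ^ Suc k)"
      by (simp only: delannoy_def sum.atMost_Suc_shift) simp
    moreover have "delannoy d s
        = 1 + (\<Sum>k\<le>d. (d choose Suc k) * (s choose Suc k) * 2 ^ Suc k)"
      by (simp only: delannoy_extend[of d "Suc d"] sum.atMost_Suc_shift) simp
    ultimately show ?thesis
      by (simp add: algebra_simps sum.distrib)
  qed
  have "(\<Sum>k\<le>d. (d choose k) * (Suc r choose Suc k) * 2 ^ Suc k) = 2 * delannoy d r + ?T"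
    by (simp add: delannoy_def algebra_simps sum.distrib sum_distrib_left)
  with split[of "Suc r"] split[of r] show ?thesis
    by simp
qed

text \<open>Substituting \<open>c ^ (d + r)\<close> into the recurrence gives the characteristic
  equation \<open>c ^ 2 = 2 * c + 1\<close>, whose positive root is
  \<open>1 + sqrt 2\<close>.\<close>

lemma delannoy_le: "real (delannoy d r) \<le> (1 + sqrt 2) ^ (d + r)"
proof (induction "d + r" arbitrary: d r rule: less_induct)
  case less
  show ?case
  proof (cases "d = 0 \<or> r = 0")
    case True
    then show ?thesis by (auto intro!: one_le_power)
  next
    case False
    then obtain d' r' where dr: "d = Suc d'" "r = Suc r'"
      by (metis not0_implies_Suc)
    let ?c = "1 + sqrt 2 :: real"
    have "real (delannoy d r) \<le> ?c ^ (d' + Suc r') + ?c ^ (Suc d' + r') + ?c ^ (d' + r')"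
      unfolding dr delannoy_Suc_Suc of_nat_add by (intro add_mono less) (auto simp: dr)
    also have "\<dots> = ?c ^ (d' + r') * (2 * ?c + 1)"
      by (simp add: algebra_simps)
    also have "2 * ?c + 1 = ?c ^ 2"
      by (simp add: power2_sum)
    finally show ?thesis
      by (simp add: dr power_add power2_eq_square mult_ac)
  qed
qed

lemma power2_one_plus_sqrt2: "(1 + sqrt 2)\<^sup>2 = 3 + 2 * sqrt 2"
  by (simp add: power2_sum)

lemma delannoy_diagonal_le: "real (delannoy n n) \<le> (3 + 2 * sqrt 2) ^ n"
  using delannoy_le[of n n]
  by (metis mult_2 power2_one_plus_sqrt2 power_mult)

text \<open>Cauchy--Schwarz applied to the binomial expansion of \<^term>\<open>(1 + sqrt 2) ^ n\<close>.\<close>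

lemma delannoy_diagonal_ge: "(3 + 2 * sqrt 2) ^ n \<le> real (n + 1) * real (delannoy n n)"
proof -
  let ?x = "\<lambda>k. real (n choose k) * sqrt 2 ^ k"
  have "(3 + 2 * sqrt 2) ^ n = ((sqrt 2 + 1) ^ n)\<^sup>2"
    by (metis add.commute power2_one_plus_sqrt2 power_mult mult.commute)
  also have "(sqrt 2 + 1) ^ n = (\<Sum>k\<le>n. ?x k)"
    by (simp add: binomial_ring)
  also have "(\<Sum>k\<le>n. ?x k)\<^sup>2 \<le> (\<Sum>k\<le>n. (?x k)\<^sup>2) * card {..n}"
    by (rule sum_squared_le_sum_of_squares)
  also have "(\<Sum>k\<le>n. (?x k)\<^sup>2) = real (delannoy n n)"
    unfolding delannoy_def of_nat_sum
  proof (intro sum.cong refl)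
    fix k
    have "(sqrt 2 ^ k)\<^sup>2 = (2::real) ^ k"
      by (metis power_mult mult.commute real_sqrt_pow2 zero_le_numeral)
    then show "(?x k)\<^sup>2 = real ((n choose k) * (n choose k) * 2 ^ k)"
      by (simp add: power_mult_distrib) (simp add: power2_eq_square)
  qed
  finally show ?thesis
    by (simp add: mult.commute)
qed

section \<open>Counting lattice points of l1-balls\<close>

text \<open>Vanishing outside \<open>A\<close> makes each integer vector indexed by \<open>A\<close>
  a single total function, so that \<open>card\<close> counts vectors.\<close>

definition l1_ball :: "'a set \<Rightarrow> nat \<Rightarrow> ('a \<Rightarrow> int) set" where
  "l1_ball A r = {v. (\<forall>x. x \<notin> A \<longrightarrow> v x = 0) \<and> (\<Sum>x\<in>A. \<bar>v x\<bar>) \<le> int r}"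

lemma l1_ball_empty [simp]: "l1_ball {} r = {\<lambda>_. 0}"
  by (auto simp: l1_ball_def)

lemma l1_ball_abs_le:
  assumes "finite A" "v \<in> l1_ball A r"
  shows "\<bar>v x\<bar> \<le> int r"
proof (cases "x \<in> A")
  case True
  then show ?thesis
    using assms member_le_sum[of x A "\<lambda>x. \<bar>v x\<bar>"] by (auto simp: l1_ball_def)
qed (use assms in \<open>auto simp: l1_ball_def\<close>)

lemma l1_ball_0:
  assumes "finite A"
  shows "l1_ball A 0 = {\<lambda>_. 0}"
proof -
  have "v = (\<lambda>_. 0)" if "v \<in> l1_ball A 0" for v
    using l1_ball_abs_le[OF assms that] by auto
  then show ?thesis by (auto simp: l1_ball_def)
qed

lemma finite_l1_ball:
  assumes "finite A"
  shows "finite (l1_ball A r)"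
proof (rule finite_subset)
  have "- int r \<le> v x \<and> v x \<le> int r" if "v \<in> l1_ball A r" for v x
    using l1_ball_abs_le[OF assms that, of x] by linarith
  then show "l1_ball A r \<subseteq> {v. \<forall>x. (x \<in> A \<longrightarrow> v x \<in> {- int r..int r}) \<and> (x \<notin> A \<longrightarrow> v x = 0)}"
    by (auto simp: l1_ball_def)
  show "finite {v. \<forall>x. (x \<in> A \<longrightarrow> v x \<in> {- int r..int r}) \<and> (x \<notin> A \<longrightarrow> v x = 0)}"
    using assms by (intro finite_set_of_finite_funs) auto
qed

lemma l1_ball_insert_iff:
  assumes "finite A" "a \<notin> A"
  shows "v \<in> l1_ball (insert a A) r \<longleftrightarrow>
    (\<forall>x. x \<noteq> a \<and> x \<notin> A \<longrightarrow> v x = 0) \<and> \<bar>v a\<bar> + (\<Sum>x\<in>A. \<bar>v x\<bar>) \<le> int r"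
  using assms by (auto simp: l1_ball_def)

text \<open>Split by the sign of \<open>v a\<close>. Moving \<open>v a\<close> one step towards 0
  carries the positive and negative parts onto the two closed halves of the ball of radius
  \<open>r\<close>. These cover that ball and overlap where \<open>v a = 0\<close>, which yields the
  last summand.\<close>

lemma card_l1_ball_insert_Suc:
  assumes A: "finite A" "a \<notin> A"
  shows "card (l1_ball (insert a A) (Suc r))
    = card (l1_ball A (Suc r)) + card (l1_ball (insert a A) r) + card (l1_ball A r)"
proof -
  let ?B = "l1_ball (insert a A)"
  have fin: "finite (?B s)" "finite (l1_ball A s)" for s
    using A by (auto intro: finite_l1_ball)
  have sum_upd: "(\<Sum>x\<in>A. \<bar>(v(a := c)) x\<bar>) = (\<Sum>x\<in>A. \<bar>v x\<bar>)" for v :: "'a \<Rightarrow> int" and c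
    using A by (intro sum.cong) auto
  have zero: "{v \<in> ?B s. v a = 0} = l1_ball A s" for s
    using A by (auto simp: l1_ball_def)
  have pos: "card {v \<in> ?B (Suc r). v a > 0} = card {v \<in> ?B r. v a \<ge> 0}"
    by (rule bij_betw_same_card[OF bij_betw_byWitness
          [where f = "\<lambda>v. v(a := v a - 1)" and f' = "\<lambda>v. v(a := v a + 1)"]])
       (auto simp: l1_ball_insert_iff[OF A] sum_upd[unfolded fun_upd_apply])
  have neg: "card {v \<in> ?B (Suc r). v a < 0} = card {v \<in> ?B r. v a \<le> 0}"
    by (rule bij_betw_same_card[OF bij_betw_byWitness
          [where f = "\<lambda>v. v(a := v a + 1)" and f' = "\<lambda>v. v(a := v a - 1)"]])
       (auto simp: l1_ball_insert_iff[OF A] sum_upd[unfolded fun_upd_apply])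
  let ?Z = "{v \<in> ?B (Suc r). v a = 0}"
    and ?P = "{v \<in> ?B (Suc r). v a > 0}" and ?N = "{v \<in> ?B (Suc r). v a < 0}"
  have "?B (Suc r) = (?Z \<union> ?P) \<union> ?N"
    by auto
  then have "card (?B (Suc r)) = card ((?Z \<union> ?P) \<union> ?N)"
    by simp
  also have "\<dots> = card (?Z \<union> ?P) + card ?N"
    using fin by (intro card_Un_disjoint) auto
  also have "card (?Z \<union> ?P) = card ?Z + card ?P"
    using fin by (intro card_Un_disjoint) auto
  also have "card ?Z + card ?P + card ?N = card (l1_ball A (Suc r)) +
      (card {v \<in> ?B r. v a \<ge> 0} + card {v \<in> ?B r. v a \<le> 0})"
    by (simp add: zero pos neg)
  also have "card {v \<in> ?B r. v a \<ge> 0} + card {v \<in> ?B r. v a \<le> 0}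
      = card ({v \<in> ?B r. v a \<ge> 0} \<union> {v \<in> ?B r. v a \<le> 0})
        + card ({v \<in> ?B r. v a \<ge> 0} \<inter> {v \<in> ?B r. v a \<le> 0})"
    using fin by (intro card_Un_Int) auto
  also have "{v \<in> ?B r. v a \<ge> 0} \<union> {v \<in> ?B r. v a \<le> 0} = ?B r"
    by auto
  also have "{v \<in> ?B r. v a \<ge> 0} \<inter> {v \<in> ?B r. v a \<le> 0} = l1_ball A r"
    by (subst zero[symmetric]) auto
  finally show ?thesis
    by simp
qed

lemma card_l1_ball: "finite A \<Longrightarrow> card (l1_ball A r) = delannoy (card A) r"
proof (induction A arbitrary: r rule: finite_induct)
  case empty
  show ?case by simp
next
  case (insert a A)
  show ?case
  proof (induction r)
    case 0
    show ?case using insert.hyps by (simp add: l1_ball_0)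
  next
    case (Suc r)
    then show ?case
      using insert by (simp add: card_l1_ball_insert_Suc delannoy_Suc_Suc)
  qed
qed

section \<open>Upper bound: words are determined by lattice points\<close>

abbreviation (input) Dinf :: "(int \<times> int) monoid" where
  "Dinf \<equiv> infinite_dihedral_group"

lemma dihedral_mult: "(a, b) \<otimes>\<^bsub>Dinf\<^esub> (c, d) = (a + b * c, b * d)"
  by (simp add: infinite_dihedral_group_def)

lemma dihedral_one: "\<one>\<^bsub>Dinf\<^esub> = (0, 1)"
  by (simp add: infinite_dihedral_group_def)

lemma dihedral_carrier: "carrier Dinf = UNIV \<times> {1, -1}"
  by (simp add: infinite_dihedral_group_def)

text \<open>Signs do not affect parity, so the coefficient sum over the reflections is even exactly
  when the word has an even number of them. Reading the second component off \<open>v\<close> avoids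
  a factor 2 in the bound.\<close>

definition exponent_value :: "(int \<times> int) set \<Rightarrow> (int \<times> int \<Rightarrow> int) \<Rightarrow> int \<times> int" where
  "exponent_value S v =
     (\<Sum>s\<in>S. v s * fst s, if even (\<Sum>s\<in>S. if snd s = -1 then v s else 0) then 1 else -1)"

lemma word_eq_exponent_value:
  assumes "finite S" "S \<subseteq> carrier Dinf" "set xs \<subseteq> S"
  shows "\<exists>v \<in> l1_ball S (length xs). foldr (\<otimes>\<^bsub>Dinf\<^esub>) xs \<one>\<^bsub>Dinf\<^esub> = exponent_value S v"
  using assms(3)
proof (induction xs)
  case Nil
  show ?case
    by (rule bexI[of _ "\<lambda>_. 0"]) (auto simp: exponent_value_def dihedral_one l1_ball_def)
next
  case (Cons x xs)
  then obtain v where v: "v \<in> l1_ball S (length xs)"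
      "foldr (\<otimes>\<^bsub>Dinf\<^esub>) xs \<one>\<^bsub>Dinf\<^esub> = exponent_value S v"
    by auto
  obtain a b where x: "x = (a, b)" by (cases x)
  have xS: "(a, b) \<in> S" and b: "b = 1 \<or> b = -1"
    using Cons.prems assms(2) by (auto simp: x dihedral_carrier)
  \<comment> \<open>Prepending \<open>(a, b)\<close> multiplies the prefix sign of every later
    letter by \<open>b\<close> and adds one occurrence of \<open>(a, b)\<close> with sign
    \<open>+\<close>.\<close>
  define w where "w s = b * v s + (if s = (a, b) then 1 else 0)" for s
  have "(\<Sum>s\<in>S. \<bar>w s\<bar>) \<le> (\<Sum>s\<in>S. \<bar>v s\<bar> + (if s = (a, b) then 1 else 0))"
    using b by (intro sum_mono) (auto simp: w_def)
  also have "\<dots> = (\<Sum>s\<in>S. \<bar>v s\<bar>) + 1"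
    using xS assms(1) by (simp add: sum.distrib)
  finally have "w \<in> l1_ball S (length (x # xs))"
    using v(1) xS by (auto simp: l1_ball_def w_def)
  moreover have "(\<Sum>s\<in>S. w s * fst s) = a + b * (\<Sum>s\<in>S. v s * fst s)"
  proof -
    have "(\<Sum>s\<in>S. w s * fst s)
        = (\<Sum>s\<in>S. b * (v s * fst s) + (if s = (a, b) then fst s else 0))"
      by (intro sum.cong) (auto simp: w_def algebra_simps)
    then show ?thesis
      using xS assms(1) by (simp add: sum.distrib sum_distrib_left)
  qed
  \<comment> \<open>Modulo 2 the factor \<open>b\<close> disappears, so the parity flips exactly
    when the new letter is a reflection.\<close>
  moreover have "(\<Sum>s\<in>S. if snd s = -1 then w s else 0)
      = b * (\<Sum>s\<in>S. if snd s = -1 then v s else 0) + (if b = -1 then 1 else 0)"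
  proof -
    have "(\<Sum>s\<in>S. if snd s = -1 then w s else 0)
        = (\<Sum>s\<in>S. b * (if snd s = -1 then v s else 0)
            + (if s = (a, b) then if b = -1 then 1 else 0 else 0))"
      by (intro sum.cong) (auto simp: w_def)
    then show ?thesis
      using xS assms(1) by (simp add: sum.distrib sum_distrib_left)
  qed
  ultimately show ?case
    using b by (intro bexI[of _ w]) (auto simp: v(2) x exponent_value_def dihedral_mult)
qed

lemma card_set_power_dihedral_le:
  assumes "finite S" "S \<subseteq> carrier Dinf"
  shows "card (set_power Dinf S n) \<le> delannoy (card S) n"
proof -
  have "set_power Dinf S n \<subseteq> exponent_value S ` l1_ball S n"
    using word_eq_exponent_value[OF assms] by (fastforce simp: set_power_def)
  then have "card (set_power Dinf S n) \<le> card (l1_ball S n)"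
    using assms(1) by (meson finite_l1_ball surj_card_le)
  then show ?thesis
    using assms(1) by (simp add: card_l1_ball)
qed

lemma product_growth_dihedral_le:
  "product_growth Dinf k n \<le> delannoy k n"
  unfolding product_growth_def
  using finite_product_growth_values product_growth_values_nonempty
  by (intro Max.boundedI) (auto intro: card_set_power_dihedral_le)

section \<open>Lower bound: lattice points realized by words\<close>

lemma set_power_Suc_left:
  "g \<in> S \<Longrightarrow> h \<in> set_power G S n \<Longrightarrow> g \<otimes>\<^bsub>G\<^esub> h \<in> set_power G S (Suc n)"
  by (force simp: set_power_def intro: exI[of _ "g # _"])

lemma (in monoid) foldr_mult_snoc:
  "set xs \<subseteq> carrier G \<Longrightarrow> g \<in> carrier G \<Longrightarrow>
    foldr (\<otimes>) xs \<one> \<in> carrier G \<and> foldr (\<otimes>) (xs @ [g]) \<one> = foldr (\<otimes>) xs \<one> \<otimes> g"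
  by (induction xs) (auto simp: m_assoc)

lemma (in monoid) set_power_Suc_right:
  assumes "S \<subseteq> carrier G" "g \<in> S" "h \<in> set_power G S n"
  shows "h \<otimes> g \<in> set_power G S (Suc n)"
proof -
  obtain xs where "h = foldr (\<otimes>) xs \<one>" "set xs \<subseteq> S" "length xs = n"
    using assms(3) by (auto simp: set_power_def)
  moreover from this(2) have "set xs \<subseteq> carrier G" "g \<in> carrier G"
    using assms by auto
  ultimately have "h \<otimes> g = foldr (\<otimes>) (xs @ [g]) \<one>" "set (xs @ [g]) \<subseteq> S"
      "length (xs @ [g]) = Suc n"
    using assms(2) foldr_mult_snoc[of xs g] by (auto simp del: foldr_append)
  then show ?thesis
    unfolding set_power_def by blast
qed

text \<open>A translation written to the left of the single reflection contributes with sign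
  \<open>+\<close>, one written to its right with sign \<open>-\<close>.\<close>

lemma l1_ball_value_in_set_power:
  fixes t :: "'a \<Rightarrow> int"
  assumes S: "S \<subseteq> carrier Dinf" "(0, 1) \<in> S" "(0, -1) \<in> S" "\<And>i. i \<in> A \<Longrightarrow> (t i, 1) \<in> S"
    and A: "finite A" and v: "v \<in> l1_ball A r"
  shows "(\<Sum>i\<in>A. v i * t i, -1) \<in> set_power Dinf S (Suc r)"
  using v
proof (induction r arbitrary: v)
  case 0
  then have "v = (\<lambda>_. 0)" using A by (simp add: l1_ball_0)
  then show ?case
    \<comment> \<open>The lone reflection is the word for the zero vector; it accounts for length
      \<open>Suc r\<close> at radius \<open>r\<close>.\<close>
    using S(3) by (auto simp: set_power_def dihedral_one dihedral_mult intro!: exI[of _ "[(0, -1)]"])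
next
  case (Suc r)
  interpret group Dinf by (rule infinite_dihedral_group_is_group)
  show ?case
  proof (cases "v \<in> l1_ball A r")
    case True
    \<comment> \<open>The identity pads the shorter word.\<close>
    from set_power_Suc_left[OF S(2) Suc.IH[OF True]] show ?thesis
      by (simp add: dihedral_mult)
  next
    case False
    have "\<exists>a\<in>A. v a \<noteq> 0"
    proof (rule ccontr)
      assume "\<not> ?thesis"
      with False Suc.prems show False by (auto simp: l1_ball_def)
    qed
    then obtain a where a: "a \<in> A" "v a \<noteq> 0" by blast
    \<comment> \<open>Moving coordinate \<open>a\<close> one step towards 0 lowers the norm by one;
      the translation \<open>t a\<close> is then put back on the side given by the sign of
      \<open>v a\<close>.\<close>
    define w where "w i = v i - (if i = a then sgn (v a) else 0)" for i
    have "(\<Sum>i\<in>A. \<bar>w i\<bar>) = (\<Sum>i\<in>A. \<bar>v i\<bar> - (if i = a then 1 else 0))"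
      using a by (intro sum.cong) (auto simp: w_def sgn_if)
    also have "\<dots> = (\<Sum>i\<in>A. \<bar>v i\<bar>) - 1"
      using a A by (simp add: sum_subtractf)
    finally have "w \<in> l1_ball A r"
      using Suc.prems a by (auto simp: l1_ball_def w_def)
    note IH = Suc.IH[OF this]
    have "(\<Sum>i\<in>A. w i * t i) = (\<Sum>i\<in>A. v i * t i - (if i = a then sgn (v a) * t a else 0))"
      by (intro sum.cong) (auto simp: w_def algebra_simps)
    also have "\<dots> = (\<Sum>i\<in>A. v i * t i) - sgn (v a) * t a"
      using a A by (simp add: sum_subtractf)
    finally have eq: "(\<Sum>i\<in>A. w i * t i) = (\<Sum>i\<in>A. v i * t i) - sgn (v a) * t a" .
    show ?thesis
    proof (cases "v a > 0")
      case True
      with set_power_Suc_left[OF S(4)[OF a(1)] IH] eq show ?thesis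
        by (simp add: dihedral_mult)
    next
      case False
      with set_power_Suc_right[OF S(1) S(4)[OF a(1)] IH] eq a show ?thesis
        by (simp add: dihedral_mult)
    qed
  qed
qed

text \<open>\<open>B\<close> divides \<open>d 0\<close>, which is smaller in absolute value and
  hence 0; dividing by \<open>B\<close> shifts the digits.\<close>

lemma digits_eq_0:
  fixes d :: "nat \<Rightarrow> int" and B :: int
  assumes "(\<Sum>i<m. d i * B ^ i) = 0" "\<And>i. i < m \<Longrightarrow> \<bar>d i\<bar> < B" "i < m"
  shows "d i = 0"
  using assms
proof (induction m arbitrary: d i)
  case (Suc m)
  have sum: "d 0 + B * (\<Sum>i<m. d (Suc i) * B ^ i) = 0"
    using Suc.prems(1) unfolding sum.lessThan_Suc_shift
    by (simp add: sum_distrib_left algebra_simps)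
  then have "B dvd d 0"
    by (metis add.inverse_unique add.commute dvd_minus_iff dvd_triv_left)
  then have d0: "d 0 = 0"
    using Suc.prems(2)[of 0] dvd_imp_le_int[of "d 0" B] by fastforce
  have "B \<noteq> 0" using Suc.prems(2)[of 0] by auto
  with sum d0 have "(\<Sum>i<m. d (Suc i) * B ^ i) = 0" by simp
  from Suc.IH[OF this] Suc.prems(2,3) d0 show ?case
    by (cases i) auto
qed simp

lemma inj_on_l1_ball_digits:
  "inj_on (\<lambda>v. \<Sum>i<m. v i * (2 * int r + 1) ^ i) (l1_ball {..<m} r)"
proof (rule inj_onI)
  fix v w assume v: "v \<in> l1_ball {..<m} r" and w: "w \<in> l1_ball {..<m} r"
    and eq: "(\<Sum>i<m. v i * (2 * int r + 1) ^ i) = (\<Sum>i<m. w i * (2 * int r + 1) ^ i)"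
  have "v i - w i = 0" if "i < m" for i
  proof (rule digits_eq_0[where d = "\<lambda>i. v i - w i" and B = "2 * int r + 1"])
    show "(\<Sum>i<m. (v i - w i) * (2 * int r + 1) ^ i) = 0"
      using eq by (simp add: left_diff_distrib sum_subtractf)
    \<comment> \<open>Both entries lie between \<open>- r\<close> and \<open>r\<close>, whence the
      base \<open>2 * r + 1\<close>.\<close>
    show "\<bar>v j - w j\<bar> < 2 * int r + 1" for j
      using l1_ball_abs_le[OF _ v, of j] l1_ball_abs_le[OF _ w, of j] by simp
  qed (rule that)
  then show "v = w"
    using v w by (intro ext)
      (metis (mono_tags, lifting) eq_iff_diff_eq_0 l1_ball_def lessThan_iff mem_Collect_eq)
qed

lemma product_growth_dihedral_ge:
  assumes "m > 0"
  shows "delannoy m m \<le> product_growth Dinf (m + 2) (m + 2)"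
proof -
  define B where "B = 2 * int m + 1"
  define S :: "(int \<times> int) set"
    where "S = insert (0, 1) (insert (0, -1) ((\<lambda>i. (B ^ i, 1)) ` {..<m}))"
  \<comment> \<open>With \<open>B > 1\<close> the powers are distinct and nonzero, so no two listed
    elements of \<open>S\<close> coincide.\<close>
  have B: "B > 1" using assms by (simp add: B_def)
  have S: "S \<subseteq> carrier Dinf" "finite S"
    by (auto simp: S_def dihedral_carrier)
  have inj: "inj_on (\<lambda>i. (B ^ i, 1 :: int)) {..<m}"
    using B by (auto simp: inj_on_def)
  have "card S = m + 2"
    using B by (auto simp: S_def card_image[OF inj] card_insert_if)
  have "inj_on (\<lambda>v. (\<Sum>i<m. v i * B ^ i, -1 :: int)) (l1_ball {..<m} m)"
    using inj_on_l1_ball_digits[of m m] by (auto simp: inj_on_def B_def)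
  moreover have "(\<lambda>v. (\<Sum>i<m. v i * B ^ i, -1)) ` l1_ball {..<m} m \<subseteq> set_power Dinf S (m + 2)"
  proof safe
    fix v assume "v \<in> l1_ball {..<m} m"
    \<comment> \<open>Radius \<open>Suc m\<close> matches word length \<open>m + 2\<close>, the size
      of \<open>S\<close>; the ball counted keeps radius \<open>m\<close>, equal to its
      dimension.\<close>
    then have "v \<in> l1_ball {..<m} (Suc m)" by (auto simp: l1_ball_def)
    from l1_ball_value_in_set_power[OF S(1) _ _ _ _ this]
    show "(\<Sum>i<m. v i * B ^ i, -1) \<in> set_power Dinf S (m + 2)"
      by (simp add: S_def)
  qed
  ultimately have "card (l1_ball {..<m} m) \<le> card (set_power Dinf S (m + 2))"
    using card_inj_on_le finite_set_power S(2) by blast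
  also have "\<dots> \<le> product_growth Dinf (m + 2) (m + 2)"
    unfolding product_growth_def
    using S \<open>card S = m + 2\<close> by (intro Max_ge finite_product_growth_values) blast
  finally show ?thesis
    by (simp add: card_l1_ball)
qed

section \<open>Convergence of the roots, and thus the limsup\<close>

lemma product_growth_dihedral_root_tendsto:
  "(\<lambda>n. root n (real (product_growth Dinf n n))) \<longlonglongrightarrow> 3 + 2 * sqrt 2"
proof -
  define q :: real where "q = 3 + 2 * sqrt 2"
  have q: "q > 0" by (simp add: q_def add_pos_nonneg)
  have "(\<lambda>n. root n (real (product_growth Dinf n n))) \<longlonglongrightarrow> q"
  proof (rule tendsto_sandwich)
    show "\<forall>\<^sub>F n in sequentially. root n (real (product_growth Dinf n n)) \<le> q"
      using eventually_gt_at_top[of 0]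
    proof eventually_elim
      case (elim n)
      have "real (product_growth Dinf n n) \<le> q ^ n"
        using product_growth_dihedral_le[of n n] delannoy_diagonal_le[of n, folded q_def]
        by (meson of_nat_le_iff order_trans)
      with elim have "root n (real (product_growth Dinf n n)) \<le> root n (q ^ n)"
        by simp
      with elim q show ?case by (simp add: real_root_power_cancel)
    qed
    \<comment> \<open>This is the n-th root of \<open>q ^ (n - 2) / n\<close>: the two extra
      elements of \<open>S\<close> cost \<open>q\<^sup>2\<close>, and \<open>n\<close> bounds the
      Cauchy--Schwarz factor \<open>m + 1\<close>. Both roots in the denominator tend to 1.\<close>
    show "\<forall>\<^sub>F n in sequentially. q / (root n (q\<^sup>2) * root n (real n))
        \<le> root n (real (product_growth Dinf n n))"
      using eventually_gt_at_top[of 2]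
    proof eventually_elim
      case (elim n)
      define m where "m = n - 2"
      have n: "n = m + 2" "m > 0" using elim by (auto simp: m_def)
      have "q ^ m \<le> real (m + 1) * real (delannoy m m)"
        by (rule delannoy_diagonal_ge[folded q_def])
      also have "\<dots> \<le> real n * real (product_growth Dinf n n)"
        using product_growth_dihedral_ge[OF n(2)] unfolding n(1)
        by (intro mult_mono) auto
      finally have "q ^ m * q\<^sup>2 \<le> real n * real (product_growth Dinf n n) * q\<^sup>2"
        by (intro mult_right_mono) auto
      moreover have "q ^ n = q ^ m * q\<^sup>2"
        by (simp add: n power_add power2_eq_square)
      ultimately have "q ^ n \<le> real (product_growth Dinf n n) * (q\<^sup>2 * real n)"
        by (simp only: mult_ac)
      then have "q ^ n / (q\<^sup>2 * real n) \<le> real (product_growth Dinf n n)"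
        using q n by (subst pos_divide_le_eq) simp_all
      then have "root n (q ^ n / (q\<^sup>2 * real n)) \<le> root n (real (product_growth Dinf n n))"
        using n by simp
      moreover have "root n (q ^ n / (q\<^sup>2 * real n)) = q / (root n (q\<^sup>2) * root n (real n))"
        using n q by (simp only: real_root_divide real_root_mult real_root_power_cancel)
      ultimately show ?case by simp
    qed
    have "(\<lambda>n. q / (root n (q\<^sup>2) * root n (real n))) \<longlonglongrightarrow> q / (1 * 1)"
      using q by (intro tendsto_intros LIMSEQ_root LIMSEQ_root_const) auto
    then show "(\<lambda>n. q / (root n (q\<^sup>2) * root n (real n))) \<longlonglongrightarrow> q"
      by simp
  qed simp
  then show ?thesis
    by (simp only: q_def)
qed

theorem theorem1p3:
  "limsup (\<lambda>n. ereal (root n (real (product_growth infinite_dihedral_group n n))))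
     = ereal (3 + 2 * sqrt 2)"
  by (intro lim_imp_Limsup tendsto_ereal product_growth_dihedral_root_tendsto) simp

end
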